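(* Let $n\ge1$, let $\Delta\subset\mathbb{R}^n$ be an $n$-simplex with vertices $\mathbf{x}_0,\dots,\mathbf{x}_n$, and let $f\colon\Delta\to\mathbb{R}$ be convex. Then $$\operatorname{Avg}(f,\Delta)\le \frac{1}{n+1}\sum_{k=1}^{n+1}\frac{1}{\binom{n+1}{k}}\sum_{\substack{K\subset N\\ \operatorname{card}K=k}}f(\mathbf{b}_K),$$ where $N=\{0,\dots,n\}$ and $\mathbf{b}_K=\frac{1}{\operatorname{card}K}\sum_{i\in K}\mathbf{x}_i$ is the barycenter of the face $\operatorname{conv}\{\mathbf{x}_i:i\in K\}$.
   Context: $\mathbf{x}_0,\dots,\mathbf{x}_n\in\mathbb{R}^n$ are affinely independent and $\Delta=\operatorname{conv}\{\mathbf{x}_0,\dots,\mathbf{x}_n\}$. $\operatorname{Avg}(f,\Delta)=\frac{1}{\operatorname{Vol}_n(\Delta)}\int_\Delta f(\mathbf{x})\,d\mathbf{x}$ (Lebesgue measure on $\mathbb{R}^n$). *)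

theory Defs
  imports "HOL-Analysis.Analysis"
begin

definition Avg :: "('a::euclidean_space \<Rightarrow> real) \<Rightarrow> 'a set \<Rightarrow> real" where
  "Avg f S = (LINT y:S|lebesgue. f y) / measure lebesgue S"

definition barycenter :: "(nat \<Rightarrow> 'a::real_vector) \<Rightarrow> nat set \<Rightarrow> 'a" where
  "barycenter x K = (1 / real (card K)) *\<^sub>R (\<Sum>i\<in>K. x i)"

end

theory Submission
  imports Defs "HOL-Combinatorics.Permutations"
begin

text \<open>Barycentric subdivision: the flag
  \<open>{\<sigma> 0} \<subset> {\<sigma> 0, \<sigma> 1} \<subset> \<dots>\<close> of faces given by a permutation \<open>\<sigma>\<close> spans, via its barycenters, the cell of
  those points whose barycentric coordinates are sorted by \<open>\<sigma>\<close>. Up to a null set the cells partition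
  the simplex, and they have equal volume because the affine maps permuting the vertices preserve the
  simplex. On each cell, convexity bounds \<open>f\<close> by the affine interpolation of its values at the
  barycenters of the flag, whose mean is the average of these values. Finally, each \<open>k\<close>-element face
  lies in the same number of flags.\<close>

section \<open>Lebesgue measure under affine bijections\<close>

lemma nn_integral_lborel_translate:
  fixes g :: "'a::euclidean_space \<Rightarrow> ennreal"
  assumes [measurable]: "g \<in> borel_measurable borel"
  shows "(\<integral>\<^sup>+x. g (a + x) \<partial>lborel) = (\<integral>\<^sup>+x. g x \<partial>lborel)"
proof -
  have "(\<integral>\<^sup>+x. g x \<partial>lborel) = (\<integral>\<^sup>+x. g x \<partial>distr lborel borel ((+) a))"
    by (simp add: lborel_distr_plus)
  also have "\<dots> = (\<integral>\<^sup>+x. g (a + x) \<partial>lborel)"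
    by (subst nn_integral_distr) auto
  finally show ?thesis ..
qed

lemma nn_integral_lborel_reflect:
  fixes g :: "'a::euclidean_space \<Rightarrow> ennreal"
  assumes [measurable]: "g \<in> borel_measurable borel"
  shows "(\<integral>\<^sup>+x. g (a - x) \<partial>lborel) = (\<integral>\<^sup>+x. g x \<partial>lborel)"
proof -
  have "lborel = distr lborel borel ((-) a)"
    using lborel_affine[of "-1" a] by (simp add: density_1)
  then have "(\<integral>\<^sup>+x. g x \<partial>lborel) = (\<integral>\<^sup>+x. g x \<partial>distr lborel borel ((-) a))"
    by simp
  also have "\<dots> = (\<integral>\<^sup>+x. g (a - x) \<partial>lborel)"
    by (subst nn_integral_distr) auto
  finally show ?thesis ..
qed

text \<open>Uniqueness of translation-invariant measures, applied to the image of Lebesgue measure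
  under an affine bijection. The library's change of variables formula needs a well-ordered
  index type and is not applicable.\<close>

lemma nn_integral_affine_proportional:
  fixes T :: "'a::euclidean_space \<Rightarrow> 'a" and g :: "'a \<Rightarrow> ennreal"
  assumes lin: "linear (\<lambda>p. T p - T 0)" and surj: "surj T"
    and [measurable]: "g \<in> borel_measurable borel" "A \<in> sets borel"
  shows "(\<integral>\<^sup>+y. g (T y) \<partial>lborel) * emeasure lborel A
       = emeasure lborel (T -` A) * (\<integral>\<^sup>+x. g x \<partial>lborel)"
proof -
  define L where "L = (\<lambda>p. T p - T 0)"
  have L: "linear L" using lin by (simp add: L_def)
  have TL: "T p = L p + T 0" for p by (simp add: L_def)
  have "continuous_on UNIV L"
    by (simp add: L linear_continuous_on linear_conv_bounded_linear[symmetric])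
  then have contT: "continuous_on UNIV T" by (subst TL[abs_def]) (intro continuous_intros)
  have [measurable]: "T \<in> borel_measurable borel"
    by (rule borel_measurable_continuous_onI[OF contT])
  have [measurable]: "T -` A \<in> sets borel"
    using measurable_sets[of T borel borel A] by simp
  \<comment> \<open>By surjectivity the linear part takes the value \<open>- x\<close> at some
    \<open>z\<close>; shifting the argument by this \<open>z\<close> shifts the value by
    \<open>- x\<close>.\<close>
  have shift: "\<exists>z. \<forall>y. T (z + y) = T y - x" for x
  proof -
    obtain z where "T z = T 0 - x" using surjD[OF surj, of "T 0 - x"] by auto
    then have "L z = - x" by (simp add: L_def)
    then have "L (z + y) = L y - x" for y by (simp add: linear_add[OF L])
    then have "T (z + y) = T y - x" for y
      using TL[of "z + y"] TL[of y] by simp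
    then show ?thesis by blast
  qed
  have "(\<integral>\<^sup>+y. indicator (T -` A) y \<partial>lborel) = emeasure lborel (T -` A)"
    by (rule nn_integral_indicator) simp
  \<comment> \<open>The product becomes a double integral. Translation in \<open>x\<close>, Fubini,
    translation in \<open>y\<close> by the \<open>z\<close> of \<open>shift\<close>, Fubini again
    and a reflection in \<open>x\<close> then separate the integral of \<open>g (T y)\<close> from
    the measure of \<open>A\<close>.\<close>
  then have "emeasure lborel (T -` A) * (\<integral>\<^sup>+x. g x \<partial>lborel)
      = (\<integral>\<^sup>+y. indicator A (T y) * (\<integral>\<^sup>+x. g x \<partial>lborel) \<partial>lborel)"
    by (subst nn_integral_multc) (simp_all only: indicator_vimage, simp_all)
  also have "\<dots> = (\<integral>\<^sup>+y. (\<integral>\<^sup>+x. indicator A (T y) * g (T y + x) \<partial>lborel) \<partial>lborel)"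
    by (simp add: nn_integral_cmult nn_integral_lborel_translate)
  also have "\<dots> = (\<integral>\<^sup>+x. (\<integral>\<^sup>+y. indicator A (T y) * g (T y + x) \<partial>lborel) \<partial>lborel)"
    by (rule lborel_pair.Fubini') measurable
  also have "\<dots> = (\<integral>\<^sup>+x. (\<integral>\<^sup>+y. indicator A (T y - x) * g (T y) \<partial>lborel) \<partial>lborel)"
  proof (rule nn_integral_cong)
    fix x :: 'a
    obtain z where z: "\<And>y. T (z + y) = T y - x" using shift by blast
    have "(\<integral>\<^sup>+y. indicator A (T y) * g (T y + x) \<partial>lborel)
        = (\<integral>\<^sup>+y. indicator A (T (z + y)) * g (T (z + y) + x) \<partial>lborel)"
      by (rule nn_integral_lborel_translate[symmetric]) measurable
    then show "(\<integral>\<^sup>+y. indicator A (T y) * g (T y + x) \<partial>lborel)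
        = (\<integral>\<^sup>+y. indicator A (T y - x) * g (T y) \<partial>lborel)"
      by (simp add: z)
  qed
  also have "\<dots> = (\<integral>\<^sup>+y. (\<integral>\<^sup>+x. indicator A (T y - x) * g (T y) \<partial>lborel) \<partial>lborel)"
    by (rule lborel_pair.Fubini') measurable
  also have "\<dots> = (\<integral>\<^sup>+y. emeasure lborel A * g (T y) \<partial>lborel)"
    by (simp add: nn_integral_multc nn_integral_lborel_reflect)
  also have "\<dots> = (\<integral>\<^sup>+y. g (T y) \<partial>lborel) * emeasure lborel A"
    by (simp add: nn_integral_cmult mult.commute)
  finally show ?thesis ..
qed

text \<open>For nonnegative measurable functions the Bochner integral is \<open>enn2real\<close> of
  the nonnegative integral, and \<open>enn2real\<close> is multiplicative. Taking for
  \<open>A\<close> a set with known preimage gives the scaling factor of \<open>T\<close> without a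
  determinant.\<close>

lemma integral_affine_proportional:
  fixes T :: "'a::euclidean_space \<Rightarrow> 'a" and g :: "'a \<Rightarrow> real"
  assumes "linear (\<lambda>p. T p - T 0)" and "surj T"
    and [measurable]: "g \<in> borel_measurable borel" "A \<in> sets borel"
    and nonneg: "\<And>x. 0 \<le> g x"
  shows "(LINT y|lborel. g (T y)) * measure lborel A
       = measure lborel (T -` A) * (LINT x|lborel. g x)"
proof -
  have "continuous_on UNIV (\<lambda>p. (T p - T 0) + T 0)"
    by (intro continuous_intros linear_continuous_on) (simp add: assms linear_conv_bounded_linear[symmetric])
  then have [measurable]: "T \<in> borel_measurable borel"
    by (intro borel_measurable_continuous_onI) simp
  have "(LINT y|lborel. g (T y)) = enn2real (\<integral>\<^sup>+y. ennreal (g (T y)) \<partial>lborel)"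
    "(LINT x|lborel. g x) = enn2real (\<integral>\<^sup>+x. ennreal (g x) \<partial>lborel)"
    by (auto intro!: integral_eq_nn_integral simp: nonneg)
  moreover have "(\<integral>\<^sup>+y. ennreal (g (T y)) \<partial>lborel) * emeasure lborel A
      = emeasure lborel (T -` A) * (\<integral>\<^sup>+x. ennreal (g x) \<partial>lborel)"
    using assms by (intro nn_integral_affine_proportional) auto
  ultimately show ?thesis
    by (metis enn2real_mult measure_def)
qed

text \<open>The zero set is a hyperplane, or empty if the linear part vanishes.\<close>

lemma negligible_affine_zeros:
  fixes h :: "'a::euclidean_space \<Rightarrow> real"
  assumes lin: "linear (\<lambda>p. h p - h 0)" and "h q \<noteq> 0"
  shows "negligible {p. h p = 0}"
proof -
  \<comment> \<open>The adjoint at 1 is the vector representing the linear part as an inner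
    product.\<close>
  define a where "a = adjoint (\<lambda>p. h p - h 0) 1"
  have h: "h p = a \<bullet> p + h 0" for p
    using adjoint_works[OF lin, of p 1] by (simp add: a_def inner_commute)
  then have "a \<noteq> 0 \<or> - h 0 \<noteq> 0"
    using \<open>h q \<noteq> 0\<close> by (metis add_0 inner_zero_left neg_0_equal_iff_equal)
  moreover have "{p. h p = 0} = {p. a \<bullet> p = - h 0}"
    by (subst h) (auto simp: eq_neg_iff_add_eq_0)
  ultimately show ?thesis by (simp add: negligible_hyperplane)
qed

section \<open>Permutations\<close>

lemma exists_sorting_permutation:
  fixes v :: "nat \<Rightarrow> 'a::linorder"
  shows "\<exists>\<sigma>. \<sigma> permutes {..n} \<and> (\<forall>i<n. v (\<sigma> i) \<le> v (\<sigma> (Suc i)))"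
proof -
  define xs where "xs = sort_key v [0..<Suc n]"
  \<comment> \<open>Entry \<open>i\<close> of the sorted index list is the image of
    \<open>i\<close>; the identity elsewhere makes this a permutation of
    \<open>{..n}\<close>.\<close>
  define \<sigma> where "\<sigma> = (\<lambda>i. if i \<le> n then xs ! i else i)"
  have len: "length xs = Suc n" and set: "set xs = {..n}"
    by (auto simp: xs_def)
  have "bij_betw (nth xs) {..<Suc n} {..n}"
    by (rule bij_betw_nth) (auto simp: xs_def)
  then have "bij_betw \<sigma> {..n} {..n}"
    by (subst bij_betw_cong[of _ _ "nth xs"]) (auto simp: \<sigma>_def lessThan_Suc_atMost)
  then have "\<sigma> permutes {..n}"
    by (rule bij_imp_permutes) (simp add: \<sigma>_def)
  moreover have "v (\<sigma> i) \<le> v (\<sigma> (Suc i))" if "i < n" for i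
  proof -
    have "sorted (map v xs)" by (simp add: xs_def)
    then have "map v xs ! i \<le> map v xs ! Suc i"
      using that len by (simp add: sorted_iff_nth_Suc del: nth_map)
    then show ?thesis using that len by (simp add: \<sigma>_def)
  qed
  ultimately show ?thesis by blast
qed

text \<open>Both permutations list the same set of values as a sorted distinct list, so the lists
  agree; injectivity of \<open>v\<close> then recovers the indices.\<close>

lemma sorting_permutation_unique:
  fixes v :: "nat \<Rightarrow> 'a::linorder"
  assumes inj: "inj_on v {..n}"
    and s: "\<sigma> permutes {..n}" "\<And>i. i < n \<Longrightarrow> v (\<sigma> i) \<le> v (\<sigma> (Suc i))"
    and t: "\<tau> permutes {..n}" "\<And>i. i < n \<Longrightarrow> v (\<tau> i) \<le> v (\<tau> (Suc i))"
  shows "\<sigma> = \<tau>"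
proof
  have *: "sorted (map (v \<circ> \<rho>) [0..<Suc n]) \<and> distinct (map (v \<circ> \<rho>) [0..<Suc n])
      \<and> set (map (v \<circ> \<rho>) [0..<Suc n]) = v ` {..n}"
    if "\<rho> permutes {..n}" "\<And>i. i < n \<Longrightarrow> v (\<rho> i) \<le> v (\<rho> (Suc i))" for \<rho>
  proof (intro conjI)
    show "sorted (map (v \<circ> \<rho>) [0..<Suc n])"
      using that(2) by (auto simp: sorted_iff_nth_Suc simp del: upt_Suc)
    have "inj_on v (\<rho> ` {..n})" using inj by (simp add: permutes_image[OF that(1)])
    then have "inj_on (v \<circ> \<rho>) {..n}"
      by (intro comp_inj_on) (simp_all add: permutes_inj_on[OF that(1)])
    then show "distinct (map (v \<circ> \<rho>) [0..<Suc n])"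
      by (simp add: distinct_map atLeast0LessThan lessThan_Suc_atMost del: upt_Suc)
    have "set (map (v \<circ> \<rho>) [0..<Suc n]) = v ` \<rho> ` {..n}"
      by (simp add: image_comp atLeast0LessThan lessThan_Suc_atMost del: upt_Suc)
    then show "set (map (v \<circ> \<rho>) [0..<Suc n]) = v ` {..n}"
      by (simp add: permutes_image[OF that(1)])
  qed
  have eq: "map (v \<circ> \<sigma>) [0..<Suc n] = map (v \<circ> \<tau>) [0..<Suc n]"
    using *[OF s] *[OF t] by (intro sorted_distinct_set_unique) auto
  fix i
  show "\<sigma> i = \<tau> i"
  proof (cases "i \<le> n")
    case True
    then have "v (\<sigma> i) = v (\<tau> i)"
      using eq by (simp add: map_eq_conv del: upt_Suc)
    moreover have "\<sigma> i \<in> {..n}" "\<tau> i \<in> {..n}"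
      using True permutes_in_image[OF s(1), of i] permutes_in_image[OF t(1), of i] by auto
    ultimately show ?thesis using inj by (auto dest: inj_onD)
  next
    case False
    then show ?thesis using permutes_not_in[OF s(1)] permutes_not_in[OF t(1)] by simp
  qed
qed

lemma exists_permutation_image_eq:
  assumes "finite S" "A \<subseteq> S" "K \<subseteq> S" "card K = card A"
  shows "\<exists>\<pi>. \<pi> permutes S \<and> \<pi> ` A = K"
proof -
  have fin: "finite A" "finite K" using assms finite_subset by auto
  obtain f where f: "bij_betw f A K"
    using fin assms(4) by (metis finite_same_card_bij)
  have "card (S - A) = card (S - K)"
    using assms fin by (simp add: card_Diff_subset)
  then obtain g where g: "bij_betw g (S - A) (S - K)"
    using assms(1) by (metis finite_Diff finite_same_card_bij)
  \<comment> \<open>A bijection from \<open>A\<close> to \<open>K\<close> is glued to one between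
    the complements in \<open>S\<close>, and to the identity outside \<open>S\<close>.\<close>
  define \<pi> where "\<pi> = (\<lambda>i. if i \<in> A then f i else if i \<in> S then g i else i)"
  have fA: "bij_betw \<pi> A K"
    using f by (subst bij_betw_cong[of _ _ f]) (auto simp: \<pi>_def)
  moreover have "bij_betw \<pi> (S - A) (S - K)"
    using g by (subst bij_betw_cong[of _ _ g]) (auto simp: \<pi>_def)
  ultimately have "bij_betw \<pi> (A \<union> (S - A)) (K \<union> (S - K))"
    by (rule bij_betw_combine) auto
  then have "bij_betw \<pi> S S"
    using assms by (simp add: Un_absorb1)
  then have "\<pi> permutes S"
    by (rule bij_imp_permutes) (use assms in \<open>auto simp: \<pi>_def\<close>)
  then show ?thesis using fA by (auto simp: bij_betw_def)
qed

text \<open>Group the permutations by the image of \<open>A\<close>: all groups have the same size,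
  so the sum is a multiple of the sum over all sets of that cardinality.\<close>

lemma sum_permutations_image:
  fixes g :: "'a set \<Rightarrow> real"
  assumes fin: "finite S" and sub: "A \<subseteq> S"
  shows "(\<Sum>\<sigma> | \<sigma> permutes S. g (\<sigma> ` A))
    = fact (card S) / real (card S choose card A) * (\<Sum>K | K \<subseteq> S \<and> card K = card A. g K)"
proof -
  define P where "P = {\<sigma>. \<sigma> permutes S}"
  define Q where "Q = {K. K \<subseteq> S \<and> card K = card A}"
  have finP: "finite P" and finQ: "finite Q"
    using fin by (auto simp: P_def Q_def finite_permutations)
  have PQ: "(\<lambda>\<sigma>. \<sigma> ` A) ` P \<subseteq> Q"
  proof clarify
    fix \<sigma> assume "\<sigma> \<in> P"
    then have s: "\<sigma> permutes S" by (simp add: P_def)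
    have "\<sigma> ` A \<subseteq> S" using permutes_image[OF s] sub by blast
    moreover have "card (\<sigma> ` A) = card A"
      by (rule card_image) (rule permutes_inj_on[OF s])
    ultimately show "\<sigma> ` A \<in> Q" by (simp add: Q_def)
  qed
  define c where "c = card {\<sigma> \<in> P. \<sigma> ` A = A}"
  have fibre: "card {\<sigma> \<in> P. \<sigma> ` A = K} = c" if K: "K \<in> Q" for K
  proof -
    obtain \<pi> where \<pi>: "\<pi> permutes S" "\<pi> ` A = K"
      using exists_permutation_image_eq[OF fin sub, of K] K by (auto simp: Q_def)
    have inv: "inv \<pi> permutes S" by (rule permutes_inv[OF \<pi>(1)])
    have invK: "inv \<pi> ` K = A"
      by (simp add: \<pi>(2)[symmetric] image_comp permutes_inv_o(2)[OF \<pi>(1)])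
    \<comment> \<open>Composition with \<open>\<pi>\<close> carries the permutations preserving
      \<open>A\<close> to those sending \<open>A\<close> onto \<open>K\<close>.\<close>
    have "bij_betw (\<lambda>\<sigma>. \<pi> \<circ> \<sigma>) {\<sigma> \<in> P. \<sigma> ` A = A} {\<sigma> \<in> P. \<sigma> ` A = K}"
    proof (rule bij_betw_byWitness[where f' = "\<lambda>\<sigma>. inv \<pi> \<circ> \<sigma>"])
      show "\<forall>\<sigma>\<in>{\<sigma> \<in> P. \<sigma> ` A = A}. inv \<pi> \<circ> (\<pi> \<circ> \<sigma>) = \<sigma>"
        "\<forall>\<sigma>\<in>{\<sigma> \<in> P. \<sigma> ` A = K}. \<pi> \<circ> (inv \<pi> \<circ> \<sigma>) = \<sigma>"
        by (simp_all only: o_assoc permutes_inv_o[OF \<pi>(1)] id_o simp_thms Ball_def)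
      show "(\<circ>) \<pi> ` {\<sigma> \<in> P. \<sigma> ` A = A} \<subseteq> {\<sigma> \<in> P. \<sigma> ` A = K}"
        using \<pi> by (clarsimp simp: P_def permutes_compose image_image[symmetric])
      show "(\<circ>) (inv \<pi>) ` {\<sigma> \<in> P. \<sigma> ` A = K} \<subseteq> {\<sigma> \<in> P. \<sigma> ` A = A}"
        using inv invK by (clarsimp simp: P_def permutes_compose image_image[symmetric])
    qed
    then show ?thesis by (simp add: c_def bij_betw_same_card)
  qed
  have group: "(\<Sum>\<sigma>\<in>P. h (\<sigma> ` A)) = real c * (\<Sum>K\<in>Q. h K)" for h :: "'a set \<Rightarrow> real"
  proof -
    have "(\<Sum>\<sigma>\<in>P. h (\<sigma> ` A)) = (\<Sum>K\<in>Q. \<Sum>\<sigma>\<in>{\<sigma> \<in> P. \<sigma> ` A = K}. h (\<sigma> ` A))"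
      by (rule sum.group[symmetric, OF finP finQ PQ])
    also have "\<dots> = (\<Sum>K\<in>Q. real c * h K)"
      by (intro sum.cong) (simp_all add: fibre)
    finally show ?thesis by (simp add: sum_distrib_left)
  qed
  \<comment> \<open>Counting, that is grouping the constant function 1, determines the common group
    size \<open>c\<close>.\<close>
  have "fact (card S) = real c * real (card S choose card A)"
    using group[of "\<lambda>_. 1"] card_permutations[OF refl fin] n_subsets[OF fin, of "card A"]
    by (simp add: P_def Q_def)
  moreover have "real (card S choose card A) \<noteq> 0"
    using card_mono[OF fin sub] by simp
  ultimately show ?thesis
    using group[of g] by (simp add: P_def Q_def)
qed

section \<open>Barycentric coordinates\<close>

text \<open>Coordinates with respect to an affine frame, kept abstract so that the geometry rests on
  these laws alone. The value 0 beyond \<open>n\<close> lets the last of the consecutive differences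
  of coordinates be treated like the others.\<close>

locale barycentric_coordinates =
  fixes x :: "nat \<Rightarrow> 'a::euclidean_space" and n :: nat and l :: "nat \<Rightarrow> 'a \<Rightarrow> real"
  assumes sum_coord: "(\<Sum>i\<le>n. l i p) = 1"
    and point_eq_sum: "(\<Sum>i\<le>n. l i p *\<^sub>R x i) = p"
    and coord_unique: "(\<Sum>i\<le>n. u i) = 1 \<Longrightarrow> i \<le> n \<Longrightarrow> l i (\<Sum>j\<le>n. u j *\<^sub>R x j) = u i"
    and coord_beyond: "n < i \<Longrightarrow> l i p = 0"
begin

text \<open>Expanding each \<open>y i\<close> in the vertices and exchanging sums writes the point
  with explicit coefficients of sum 1, which uniqueness identifies as its coordinates.\<close>

lemma coord_affine_combination:
  assumes "finite I" "(\<Sum>i\<in>I. u i) = 1"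
  shows "l j (\<Sum>i\<in>I. u i *\<^sub>R y i) = (\<Sum>i\<in>I. u i * l j (y i))"
proof (cases "j \<le> n")
  case True
  have "(\<Sum>i\<in>I. u i *\<^sub>R y i) = (\<Sum>i\<in>I. u i *\<^sub>R (\<Sum>m\<le>n. l m (y i) *\<^sub>R x m))"
    by (simp add: point_eq_sum)
  also have "\<dots> = (\<Sum>m\<le>n. (\<Sum>i\<in>I. u i * l m (y i)) *\<^sub>R x m)"
    by (simp add: scaleR_sum_right scaleR_sum_left sum.swap[of _ I])
  finally have eq: "(\<Sum>i\<in>I. u i *\<^sub>R y i) = (\<Sum>m\<le>n. (\<Sum>i\<in>I. u i * l m (y i)) *\<^sub>R x m)" .
  have "(\<Sum>m\<le>n. \<Sum>i\<in>I. u i * l m (y i)) = (\<Sum>i\<in>I. u i * (\<Sum>m\<le>n. l m (y i)))"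
    by (simp add: sum_distrib_left sum.swap[of _ I])
  then have "(\<Sum>m\<le>n. \<Sum>i\<in>I. u i * l m (y i)) = 1"
    by (simp add: sum_coord assms)
  then show ?thesis using coord_unique True by (simp add: eq)
qed (simp add: coord_beyond)

lemma coord_vertex:
  assumes "i \<le> n" shows "l j (x i) = of_bool (i = j)"
proof (cases "j \<le> n")
  case True
  have "(\<Sum>m\<le>n. of_bool (i = m) *\<^sub>R x m) = (\<Sum>m\<le>n. if i = m then x m else 0)"
    by (intro sum.cong) auto
  also have "\<dots> = x i" using assms by simp
  finally show ?thesis
    using coord_unique[of "\<lambda>m. of_bool (i = m)" j] True assms by (simp add: of_bool_def)
qed (use assms in \<open>auto simp: coord_beyond\<close>)

lemma linear_coord: "linear (\<lambda>p. l i p - l i 0)"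
proof (rule linearI)
  fix p q :: 'a and c :: real
  show "l i (p + q) - l i 0 = l i p - l i 0 + (l i q - l i 0)"
    \<comment> \<open>The sum is the affine combination of \<open>p\<close>, \<open>q\<close> and
      the origin with weights 1, 1, -1; the multiple below has weights \<open>c\<close> and
      \<open>1 - c\<close> on \<open>p\<close> and the origin.\<close>
    using coord_affine_combination[of "{0,1,2::nat}" "\<lambda>k. if k = 2 then -1 else 1" i
        "\<lambda>k. if k = 0 then p else if k = 1 then q else 0"] by simp
  show "l i (c *\<^sub>R p) - l i 0 = c *\<^sub>R (l i p - l i 0)"
    using coord_affine_combination[of "{0,1::nat}" "\<lambda>k. if k = 0 then c else 1 - c" i
        "\<lambda>k. if k = 0 then p else 0"] by (simp add: algebra_simps)
qed

lemma continuous_coord: "continuous_on S (l i)"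
proof -
  have "continuous_on S (\<lambda>p. (l i p - l i 0) + l i 0)"
    by (intro continuous_on_add continuous_on_const linear_continuous_on)
       (simp add: linear_coord linear_conv_bounded_linear[symmetric])
  then show ?thesis by simp
qed

lemma borel_measurable_coord [measurable]: "l i \<in> borel_measurable borel"
  by (rule borel_measurable_continuous_onI) (rule continuous_coord)

section \<open>The simplex and its affine maps\<close>

definition Delta :: "'a set" where "Delta = {p. \<forall>i\<le>n. 0 \<le> l i p}"

lemma convex_hull_vertices: "convex hull (x ` {..n}) = Delta"
proof
  have "convex Delta"
  proof (rule convexI)
    fix p q and u v :: real
    assume "p \<in> Delta" "q \<in> Delta" "0 \<le> u" "0 \<le> v" "u + v = 1"
    moreover from this have "l i (u *\<^sub>R p + v *\<^sub>R q) = u * l i p + v * l i q" for i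
      using coord_affine_combination[of "{0,1::nat}" "\<lambda>k. if k = 0 then u else v" i
        "\<lambda>k. if k = 0 then p else q"] by simp
    ultimately show "u *\<^sub>R p + v *\<^sub>R q \<in> Delta" by (simp add: Delta_def)
  qed
  moreover have "x ` {..n} \<subseteq> Delta" by (auto simp: Delta_def coord_vertex)
  ultimately show "convex hull (x ` {..n}) \<subseteq> Delta" by (rule hull_minimal[rotated])
  show "Delta \<subseteq> convex hull (x ` {..n})"
  proof
    fix p assume p: "p \<in> Delta"
    have "(\<Sum>i\<le>n. l i p *\<^sub>R x i) \<in> convex hull (x ` {..n})"
      by (rule convex_sum) (use p in \<open>auto simp: Delta_def sum_coord hull_inc\<close>)
    then show "p \<in> convex hull (x ` {..n})" by (simp add: point_eq_sum)
  qed
qed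

lemma compact_Delta: "compact Delta"
  by (simp add: convex_hull_vertices[symmetric] compact_convex_hull finite_imp_compact)

lemma open_positive_coords: "open {p. \<forall>i\<le>n. 0 < l i p}"
proof -
  have "{p. \<forall>i\<le>n. 0 < l i p} = (\<Inter>i\<le>n. {p. 0 < l i p})" by auto
  then show ?thesis by (auto intro!: open_Collect_less continuous_coord)
qed

text \<open>The centroid has only positive coordinates, so the simplex contains a nonempty open
  set.\<close>

lemma measure_Delta_pos: "0 < measure lebesgue Delta"
proof -
  define U where "U = {p. \<forall>i\<le>n. 0 < l i p}"
  have "(\<Sum>i\<le>n. (1 / (real n + 1)) *\<^sub>R x i) \<in> U"
    by (auto simp: U_def coord_unique)
  moreover have "open U" unfolding U_def by (rule open_positive_coords)
  ultimately have "\<not> negligible U" using open_not_negligible by blast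
  moreover have "U \<subseteq> Delta" by (auto simp: U_def Delta_def less_imp_le)
  ultimately have "\<not> negligible Delta" using negligible_subset by blast
  then have "measure lebesgue Delta \<noteq> 0"
    using lmeasurable_compact[OF compact_Delta] by (simp add: negligible_iff_measure)
  then show ?thesis by (simp add: zero_less_measure_iff)
qed

text \<open>The difference of the two coordinates is affine and equals 1 at \<open>x i\<close>. For
  \<open>j\<close> beyond \<open>n\<close> this covers the hyperplane of a facet.\<close>

lemma negligible_coord_eq:
  assumes "i \<le> n" "i \<noteq> j" shows "negligible {p. l i p = l j p}"
proof -
  have "linear (\<lambda>p. (l i p - l i 0) - (l j p - l j 0))"
    by (intro linear_compose_sub linear_coord)
  then have "linear (\<lambda>p. (l i p - l j p) - (l i 0 - l j 0))"
    by (simp add: algebra_simps)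
  then show ?thesis
    using negligible_affine_zeros[of "\<lambda>p. l i p - l j p" "x i"] assms by (simp add: coord_vertex)
qed

text \<open>The affine map sending each vertex \<open>x i\<close> to \<open>y i\<close>.\<close>

definition affine_ext :: "(nat \<Rightarrow> 'a) \<Rightarrow> 'a \<Rightarrow> 'a" where
  "affine_ext y p = (\<Sum>i\<le>n. l i p *\<^sub>R y i)"

lemma linear_affine_ext: "linear (\<lambda>p. affine_ext y p - affine_ext y 0)"
proof -
  have "linear (\<lambda>p. \<Sum>i\<le>n. (l i p - l i 0) *\<^sub>R y i)"
    by (rule linear_compose_sum)
      (intro ballI linear_compose[OF linear_coord, unfolded comp_def] bounded_linear.linear
        bounded_linear_scaleR_left)
  then show ?thesis
    by (simp add: affine_ext_def scaleR_diff_left sum_subtractf)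
qed

text \<open>The functions \<open>m\<close> recover the coordinates of \<open>p\<close> from its
  image, so the map is injective, and an injective affine self-map in finite dimension is
  surjective.\<close>

lemma surj_affine_ext:
  assumes inv: "\<And>p k. k \<le> n \<Longrightarrow> m k (affine_ext y p) = l k p"
  shows "surj (affine_ext y)"
proof -
  have "inj (affine_ext y)"
  proof (rule injI)
    fix p q assume "affine_ext y p = affine_ext y q"
    then have "(\<Sum>i\<le>n. l i p *\<^sub>R x i) = (\<Sum>i\<le>n. l i q *\<^sub>R x i)"
      by (metis (no_types, lifting) inv atMost_iff sum.cong)
    then show "p = q" by (simp add: point_eq_sum)
  qed
  then have "inj (\<lambda>p. affine_ext y p - affine_ext y 0)" by (auto simp: inj_on_def)
  then have s: "surj (\<lambda>p. affine_ext y p - affine_ext y 0)"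
    by (rule linear_injective_imp_surjective[OF linear_affine_ext]) simp
  show ?thesis
  unfolding surj_def
  proof
    fix q
    obtain p where "q - affine_ext y 0 = affine_ext y p - affine_ext y 0"
      using surjD[OF s] by blast
    then show "\<exists>p. q = affine_ext y p" by (intro exI[of _ p]) simp
  qed
qed

section \<open>Integrability of convex functions on the simplex\<close>

text \<open>The function is bounded on the simplex, continuous on its interior by convexity, and the
  boundary is a null set.\<close>

lemma integrable_convex:
  assumes f: "convex_on Delta f" and "0 < n"
  shows "set_integrable lebesgue Delta f"
proof -
  have vx: "x i \<in> Delta" if "i \<le> n" for i
    using that by (auto simp: Delta_def coord_vertex)
  define M where "M = (\<Sum>i\<le>n. \<bar>f (x i)\<bar>)"
  have upper: "f p \<le> M" if "p \<in> Delta" for p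
  proof -
    have l0: "0 \<le> l i p" if "i \<le> n" for i using \<open>p \<in> Delta\<close> that by (simp add: Delta_def)
    have l1: "l i p \<le> 1" if "i \<le> n" for i
      using member_le_sum[of i "{..n}" "\<lambda>i. l i p"] l0 that by (simp add: sum_coord)
    have "f (\<Sum>i\<le>n. l i p *\<^sub>R x i) \<le> (\<Sum>i\<le>n. l i p * f (x i))"
      by (rule convex_on_sum[OF _ _ f]) (auto simp: l0 sum_coord vx)
    also have "\<dots> \<le> M"
      unfolding M_def
    proof (rule sum_mono)
      fix i assume "i \<in> {..n}"
      then have "l i p * f (x i) \<le> l i p * \<bar>f (x i)\<bar>" by (intro mult_left_mono) (auto simp: l0)
      also have "\<dots> \<le> 1 * \<bar>f (x i)\<bar>" using \<open>i \<in> {..n}\<close> by (intro mult_right_mono) (auto simp: l1)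
      finally show "l i p * f (x i) \<le> \<bar>f (x i)\<bar>" by simp
    qed
    finally show ?thesis by (simp add: point_eq_sum)
  qed
  define c where "c = (\<Sum>i\<le>n. (1 / (real n + 1)) *\<^sub>R x i)"
  \<comment> \<open>The centroid c lies on the segment from p to the point q with coordinates (1 - l i p) / n,
    so the upper bound at q turns into a lower bound at p.\<close>
  have lower: "(real n + 1) * f c - real n * M \<le> f p" if p: "p \<in> Delta" for p
  proof -
    define q where "q = (\<Sum>i\<le>n. ((1 - l i p) / real n) *\<^sub>R x i)"
    have s1: "(\<Sum>i\<le>n. (1 - l i p) / real n) = 1"
      using \<open>0 < n\<close> by (simp flip: sum_divide_distrib add: sum_subtractf sum_coord)
    have l0: "0 \<le> l i p" if "i \<le> n" for i using p that by (simp add: Delta_def)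
    have l1: "l i p \<le> 1" if "i \<le> n" for i
      using member_le_sum[of i "{..n}" "\<lambda>i. l i p"] l0 that by (simp add: sum_coord)
    have q: "q \<in> Delta"
      using l1 \<open>0 < n\<close> by (auto simp: Delta_def q_def coord_unique[OF s1])
    have "(real n + 1) *\<^sub>R c = (\<Sum>i\<le>n. x i)"
      by (simp add: c_def flip: scaleR_sum_right)
    moreover have "p + real n *\<^sub>R q = (\<Sum>i\<le>n. l i p *\<^sub>R x i) + (\<Sum>i\<le>n. (1 - l i p) *\<^sub>R x i)"
      using \<open>0 < n\<close> by (simp add: point_eq_sum q_def scaleR_sum_right)
    then have "p + real n *\<^sub>R q = (\<Sum>i\<le>n. x i)"
      by (simp flip: sum.distrib scaleR_add_left)
    ultimately have "(real n + 1) *\<^sub>R c = p + real n *\<^sub>R q" by simp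
    moreover have "c = (1 / (real n + 1)) *\<^sub>R ((real n + 1) *\<^sub>R c)" by simp
    ultimately have "c = (1 / (real n + 1)) *\<^sub>R (p + real n *\<^sub>R q)" by metis
    then have c: "c = (1 / (real n + 1)) *\<^sub>R p + (real n / (real n + 1)) *\<^sub>R q"
      by (simp add: scaleR_add_right)
    have "f c \<le> 1 / (real n + 1) * f p + real n / (real n + 1) * f q"
    proof -
      have *: "f (u *\<^sub>R p + v *\<^sub>R q) \<le> u * f p + v * f q" if "0 \<le> u" "0 \<le> v" "u + v = 1" for u v
        using f p q that by (auto simp: convex_on_def)
      show ?thesis unfolding c by (rule *) (simp_all add: add_divide_distrib[symmetric])
    qed
    also have "\<dots> \<le> 1 / (real n + 1) * f p + real n / (real n + 1) * M"
      by (intro add_left_mono mult_left_mono upper q) simp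
    also have "\<dots> = (f p + real n * M) / (real n + 1)"
      by (simp add: add_divide_distrib)
    finally show ?thesis by (simp add: pos_le_divide_eq algebra_simps)
  qed
  define B where "B = \<bar>M\<bar> + \<bar>(real n + 1) * f c - real n * M\<bar>"
  have bound: "norm (f p) \<le> B" if "p \<in> Delta" for p
    using upper[OF that] lower[OF that] by (simp add: B_def)
  define U where "U = {p. \<forall>i\<le>n. 0 < l i p}"
  have sub: "U \<subseteq> Delta" by (auto simp: U_def Delta_def less_imp_le)
  have "open U" unfolding U_def by (rule open_positive_coords)
  have "convex U"
  proof (rule convexI)
    fix p q and u v :: real
    assume *: "p \<in> U" "q \<in> U" "0 \<le> u" "0 \<le> v" "u + v = 1"
    moreover from this have "l i (u *\<^sub>R p + v *\<^sub>R q) = u * l i p + v * l i q" for i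
      using coord_affine_combination[of "{0,1::nat}" "\<lambda>k. if k = 0 then u else v" i
        "\<lambda>k. if k = 0 then p else q"] by simp
    moreover have "0 < u * l i p + v * l i q" if "i \<le> n" for i
    proof (cases "u = 0")
      case False
      then have "0 < u * l i p" "0 \<le> v * l i q"
        using * that by (auto simp: U_def less_imp_le)
      then show ?thesis by linarith
    qed (use * that in \<open>auto simp: U_def\<close>)
    ultimately show "u *\<^sub>R p + v *\<^sub>R q \<in> U" by (simp add: U_def)
  qed
  then have "convex_on U f" using f sub by (rule convex_on_subset[rotated 2])
  then have "continuous_on U f" using \<open>open U\<close> by (intro convex_on_continuous)
  then have "f \<in> borel_measurable (lebesgue_on U)"
    using \<open>open U\<close> by (intro continuous_imp_measurable_on_sets_lebesgue) auto
  moreover have "U \<in> lmeasurable"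
    by (rule bounded_set_imp_lmeasurable)
      (use \<open>open U\<close> sub bounded_subset compact_imp_bounded[OF compact_Delta] in auto)
  ultimately have "f absolutely_integrable_on U"
    using bound sub by (intro measurable_bounded_by_integrable_imp_absolutely_integrable[where g="\<lambda>_. B"])
       (auto intro: integrable_on_const)
  \<comment> \<open>A boundary point has some coordinate 0, which is expressed as equality with the
    coordinate \<open>Suc n\<close>, 0 by convention.\<close>
  moreover have "negligible (Delta - U)"
  proof (rule negligible_subset)
    show "negligible (\<Union>i\<le>n. {p. l i p = l (Suc n) p})"
      by (auto intro!: negligible_Union negligible_coord_eq)
    show "Delta - U \<subseteq> (\<Union>i\<le>n. {p. l i p = l (Suc n) p})"
      by (force simp: Delta_def U_def coord_beyond)
  qed
  then have "negligible {p \<in> Delta - U. f p \<noteq> 0}" by (rule negligible_subset) blast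
  moreover have "negligible {p \<in> U - Delta. f p \<noteq> 0}"
    by (rule negligible_subset[OF negligible_empty]) (use sub in blast)
  ultimately show ?thesis
    using absolutely_integrable_spike_set_eq[of U Delta f] by blast
qed

section \<open>The cells of the barycentric subdivision\<close>

text \<open>Position \<open>k\<close> belongs to the face of the flag with \<open>k + 1\<close>
  vertices.\<close>

definition flag_barycenter :: "(nat \<Rightarrow> nat) \<Rightarrow> nat \<Rightarrow> 'a" where
  "flag_barycenter \<sigma> k = barycenter x (\<sigma> ` {..k})"

text \<open>The barycentric coordinates of the cell. For \<open>k = n\<close> the subtracted coordinate is the one
  of the nonexistent vertex \<open>n + 1\<close>, which is 0 by convention.\<close>

definition flag_coord :: "(nat \<Rightarrow> nat) \<Rightarrow> nat \<Rightarrow> 'a \<Rightarrow> real" where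
  "flag_coord \<sigma> k p = real (Suc k) * (l (\<sigma> k) p - l (\<sigma> (Suc k)) p)"

text \<open>The simplex spanned by the flag barycenters, described like \<open>Delta\<close> by
  nonnegative coordinates.\<close>

definition flag_cell :: "(nat \<Rightarrow> nat) \<Rightarrow> 'a set" where
  "flag_cell \<sigma> = {p. \<forall>k\<le>n. 0 \<le> flag_coord \<sigma> k p}"

lemma borel_measurable_flag_coord [measurable]: "flag_coord \<sigma> k \<in> borel_measurable borel"
  unfolding flag_coord_def[abs_def] by measurable

lemma continuous_flag_coord: "continuous_on S (flag_coord \<sigma> k)"
  unfolding flag_coord_def[abs_def] by (intro continuous_intros continuous_coord)

lemma coord_affine_ext: "l j (affine_ext y p) = (\<Sum>i\<le>n. l i p * l j (y i))"
  unfolding affine_ext_def by (rule coord_affine_combination) (simp_all add: sum_coord)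

lemma coord_barycenter:
  assumes "K \<subseteq> {..n}" "K \<noteq> {}"
  shows "l j (barycenter x K) = of_bool (j \<in> K) / real (card K)"
proof -
  have fin: "finite K" using assms(1) finite_subset by blast
  have "l j (barycenter x K) = (\<Sum>i\<in>K. 1 / real (card K) * l j (x i))"
    using coord_affine_combination[OF fin, of "\<lambda>_. 1 / real (card K)" j x] fin assms
    by (simp add: barycenter_def scaleR_sum_right)
  also have "\<dots> = (\<Sum>i\<in>K. if i = j then 1 / real (card K) else 0)"
    using assms by (intro sum.cong) (auto simp: coord_vertex)
  finally show ?thesis using fin by simp
qed

text \<open>Identifies \<open>flag_coord\<close> as the coordinates for the flag barycenters: the
  coordinates with indices \<open>\<sigma> k\<close> and \<open>\<sigma> (Suc k)\<close> differ only
  at the barycenter of position \<open>k\<close>, there by \<open>1 / (k + 1)\<close>, which the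
  factor \<open>Suc k\<close> normalizes.\<close>

lemma flag_coord_affine_ext:
  assumes "\<sigma> permutes {..n}" "k \<le> n"
  shows "flag_coord \<sigma> k (affine_ext (flag_barycenter \<sigma>) p) = l k p"
proof -
  have inj: "inj \<sigma>" using assms(1) by (rule permutes_inj)
  have b: "l (\<sigma> j) (flag_barycenter \<sigma> i) = of_bool (j \<le> i) / real (Suc i)" if "i \<le> n" for i j
  proof -
    have "\<sigma> ` {..i} \<subseteq> {..n}"
      using permutes_image[OF assms(1)] that by (metis atMost_subset_iff image_mono)
    then show ?thesis
      by (simp add: flag_barycenter_def coord_barycenter inj_image_mem_iff[OF inj]
          card_image[OF inj_on_subset[OF inj]])
  qed
  have "flag_coord \<sigma> k (affine_ext (flag_barycenter \<sigma>) p)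
      = (\<Sum>i\<le>n. l i p * (real (Suc k) * (of_bool (k \<le> i) - of_bool (Suc k \<le> i)) / real (Suc i)))"
    unfolding flag_coord_def coord_affine_ext sum_subtractf[symmetric] sum_distrib_left
    by (intro sum.cong refl) (simp add: b algebra_simps diff_divide_distrib del: of_nat_Suc)
  also have "\<dots> = (\<Sum>i\<le>n. if i = k then l k p else 0)"
  proof (intro sum.cong refl)
    fix i
    have "of_bool (k \<le> i) - of_bool (Suc k \<le> i) = (of_bool (i = k) :: real)"
      by (cases k i rule: linorder_cases) auto
    then show "l i p * (real (Suc k) * (of_bool (k \<le> i) - of_bool (Suc k \<le> i)) / real (Suc i))
        = (if i = k then l k p else 0)"
      by (simp del: of_nat_Suc)
  qed
  also have "\<dots> = l k p" using assms(2) by simp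
  finally show ?thesis .
qed

text \<open>The affine map permuting the vertices permutes the coordinates in the same way; beyond
  \<open>n\<close> the permutation is the identity and both sides are 0.\<close>

lemma coord_affine_ext_permute:
  assumes "\<sigma> permutes {..n}"
  shows "l (\<sigma> j) (affine_ext (x \<circ> \<sigma>) p) = l j p"
proof (cases "j \<le> n")
  case True
  have "l (\<sigma> j) (affine_ext (x \<circ> \<sigma>) p) = (\<Sum>i\<le>n. if i = j then l j p else 0)"
    unfolding coord_affine_ext
  proof (intro sum.cong refl)
    fix i assume "i \<in> {..n}"
    then have "\<sigma> i \<le> n" using permutes_in_image[OF assms, of i] by simp
    then show "l i p * l (\<sigma> j) ((x \<circ> \<sigma>) i) = (if i = j then l j p else 0)"
      using permutes_inj[OF assms] by (simp add: coord_vertex inj_eq)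
  qed
  then show ?thesis using True by simp
next
  case False
  then show ?thesis using permutes_not_in[OF assms, of j] by (simp add: coord_beyond)
qed

lemma flag_coord_affine_ext_permute:
  assumes "\<sigma> permutes {..n}"
  shows "flag_coord \<sigma> k (affine_ext (x \<circ> \<sigma>) p) = flag_coord id k p"
  by (simp add: flag_coord_def coord_affine_ext_permute[OF assms])

lemma affine_ext_permute_mem_Delta:
  assumes "\<sigma> permutes {..n}"
  shows "affine_ext (x \<circ> \<sigma>) p \<in> Delta \<longleftrightarrow> p \<in> Delta"
proof -
  have "affine_ext (x \<circ> \<sigma>) p \<in> Delta \<longleftrightarrow> (\<forall>i\<in>\<sigma> ` {..n}. 0 \<le> l i (affine_ext (x \<circ> \<sigma>) p))"
    by (auto simp: Delta_def permutes_image[OF assms])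
  also have "\<dots> \<longleftrightarrow> p \<in> Delta"
    by (auto simp: coord_affine_ext_permute[OF assms] Delta_def)
  finally show ?thesis .
qed

text \<open>Nonnegative cell coordinates mean that the coordinates decrease along
  \<open>\<sigma>\<close>. The final comparison, with the convention value 0, amounts to membership
  in \<open>Delta\<close>.\<close>

lemma mem_flag_cell_iff:
  assumes "\<sigma> permutes {..n}"
  shows "p \<in> flag_cell \<sigma> \<longleftrightarrow> p \<in> Delta \<and> (\<forall>i<n. l (\<sigma> (Suc i)) p \<le> l (\<sigma> i) p)"
proof -
  have last: "l (\<sigma> (Suc n)) p = 0"
    using permutes_not_in[OF assms, of "Suc n"] by (simp add: coord_beyond)
  have cell: "p \<in> flag_cell \<sigma> \<longleftrightarrow> (\<forall>k\<le>n. l (\<sigma> (Suc k)) p \<le> l (\<sigma> k) p)"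
    by (simp add: flag_cell_def flag_coord_def zero_le_mult_iff)
  have "p \<in> Delta" if "p \<in> flag_cell \<sigma>"
  proof -
    \<comment> \<open>Downward induction from the coordinate \<open>Suc n\<close>, which is
      0.\<close>
    have "0 \<le> l (\<sigma> k) p" if "k \<le> Suc n" for k
      using that
    proof (induction rule: inc_induct)
      case (step k)
      then have "l (\<sigma> (Suc k)) p \<le> l (\<sigma> k) p"
        using \<open>p \<in> flag_cell \<sigma>\<close> cell by simp
      then show ?case using step.IH by linarith
    qed (simp add: last)
    then have "\<forall>i\<in>\<sigma> ` {..n}. 0 \<le> l i p" by simp
    then show ?thesis by (simp only: Delta_def permutes_image[OF assms]) simp
  qed
  moreover have "l (\<sigma> (Suc n)) p \<le> l (\<sigma> n) p" if "p \<in> Delta"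
    using that last permutes_in_image[OF assms, of n] by (simp add: Delta_def)
  ultimately show ?thesis unfolding cell by (metis le_eq_less_or_eq order_less_imp_le)
qed

lemma compact_flag_cell:
  assumes "\<sigma> permutes {..n}" shows "compact (flag_cell \<sigma>)"
proof -
  have "flag_cell \<sigma> = (\<Inter>k\<le>n. {p. 0 \<le> flag_coord \<sigma> k p})" by (auto simp: flag_cell_def)
  then have "closed (flag_cell \<sigma>)"
    by (auto intro!: closed_Collect_le continuous_flag_coord)
  moreover have "flag_cell \<sigma> \<subseteq> Delta" using mem_flag_cell_iff[OF assms] by blast
  ultimately show ?thesis using compact_Delta
    by (metis compact_Int_closed inf.absorb2)
qed

lemma sets_Delta [measurable]: "Delta \<in> sets borel"
  by (rule borel_compact[OF compact_Delta])

lemma sets_flag_cell: "\<sigma> permutes {..n} \<Longrightarrow> flag_cell \<sigma> \<in> sets borel"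
  by (rule borel_compact[OF compact_flag_cell])

section \<open>Volumes of the cells and integrals of their coordinates\<close>

text \<open>The coordinates sum to 1 and by symmetry have equal integrals, so each takes an equal
  share of the volume.\<close>

lemma integral_coord:
  assumes "k \<le> n"
  shows "(LINT p|lborel. indicator Delta p * l k p) = measure lborel Delta / real (Suc n)"
proof -
  have V: "0 < measure lborel Delta" using measure_Delta_pos by simp
  have same: "(LINT p|lborel. indicator Delta p * l j p) = (LINT p|lborel. indicator Delta p * l 0 p)"
    if "j \<le> n" for j
  proof -
    \<comment> \<open>Swapping vertices 0 and \<open>j\<close> maps the simplex to itself, so the
      scaling factor is 1, and it exchanges the two coordinates.\<close>
    define \<sigma> where "\<sigma> = Transposition.transpose 0 j"
    have \<sigma>: "\<sigma> permutes {..n}" unfolding \<sigma>_def by (rule permutes_swap_id) (use that in auto)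
    have surj: "surj (affine_ext (x \<circ> \<sigma>))"
      by (rule surj_affine_ext[where m = "\<lambda>k. l (\<sigma> k)"]) (rule coord_affine_ext_permute[OF \<sigma>])
    have "l j (affine_ext (x \<circ> \<sigma>) p) = l 0 p" for p
      using coord_affine_ext_permute[OF \<sigma>, of 0 p] by (simp add: \<sigma>_def)
    moreover have "affine_ext (x \<circ> \<sigma>) -` Delta = Delta"
      by (auto simp: affine_ext_permute_mem_Delta[OF \<sigma>])
    moreover have "indicator Delta (affine_ext (x \<circ> \<sigma>) p) = (indicator Delta p :: real)" for p
      by (simp add: indicator_def affine_ext_permute_mem_Delta[OF \<sigma>])
    moreover have "0 \<le> indicator Delta p * l j p" for p
      using that by (auto simp: indicator_def Delta_def)
    ultimately show ?thesis
      using integral_affine_proportional[OF linear_affine_ext surj, of "\<lambda>p. indicator Delta p * l j p" Delta] V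
      by simp
  qed
  have int: "integrable lborel (\<lambda>p. indicator Delta p * l j p)" for j
    using borel_integrable_compact[OF compact_Delta continuous_coord, of j] by simp
  have "(\<Sum>j\<le>n. (LINT p|lborel. indicator Delta p * l j p))
      = (LINT p|lborel. (\<Sum>j\<le>n. indicator Delta p * l j p))"
    by (rule Bochner_Integration.integral_sum[symmetric]) (rule int)
  also have "\<dots> = measure lborel Delta"
    by (simp add: sum_distrib_left[symmetric] sum_coord)
  finally have "(\<Sum>j\<le>n. (LINT p|lborel. indicator Delta p * l j p)) = measure lborel Delta" .
  moreover have "(\<Sum>j\<le>n. (LINT p|lborel. indicator Delta p * l j p))
      = (\<Sum>j\<le>n. (LINT p|lborel. indicator Delta p * l 0 p))"
    by (intro sum.cong refl same) simp
  ultimately have "real (Suc n) * (LINT p|lborel. indicator Delta p * l 0 p) = measure lborel Delta"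
    by simp
  then show ?thesis using same[OF assms] by (simp add: field_simps)
qed

text \<open>The affine map of the simplex onto the cell turns \<open>flag_coord \<sigma> k\<close>
  into \<open>l k\<close>, so the preceding integral transfers after scaling by the ratio of
  volumes.\<close>

lemma integral_flag_coord:
  assumes \<sigma>: "\<sigma> permutes {..n}" and "k \<le> n"
  shows "(LINT p|lborel. indicator (flag_cell \<sigma>) p * flag_coord \<sigma> k p)
    = measure lborel (flag_cell \<sigma>) / real (Suc n)"
proof -
  have V: "0 < measure lborel Delta" using measure_Delta_pos by simp
  note [measurable] = sets_flag_cell[OF \<sigma>]
  let ?T = "affine_ext (flag_barycenter \<sigma>)"
  have surj: "surj ?T"
    by (rule surj_affine_ext[where m = "flag_coord \<sigma>"]) (rule flag_coord_affine_ext[OF \<sigma>])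
  have mem: "?T p \<in> flag_cell \<sigma> \<longleftrightarrow> p \<in> Delta" for p
    by (simp add: flag_cell_def Delta_def flag_coord_affine_ext[OF \<sigma>])
  then have "?T -` flag_cell \<sigma> = Delta" by auto
  moreover have "indicator (flag_cell \<sigma>) (?T p) = (indicator Delta p :: real)" for p
    by (simp add: indicator_def mem)
  moreover have "0 \<le> indicator (flag_cell \<sigma>) p * flag_coord \<sigma> k p" for p
    using \<open>k \<le> n\<close> by (auto simp: indicator_def flag_cell_def)
  ultimately have "(LINT p|lborel. indicator Delta p * l k p) * measure lborel (flag_cell \<sigma>)
      = measure lborel Delta * (LINT p|lborel. indicator (flag_cell \<sigma>) p * flag_coord \<sigma> k p)"
    using integral_affine_proportional[OF linear_affine_ext surj,
        of "\<lambda>p. indicator (flag_cell \<sigma>) p * flag_coord \<sigma> k p" "flag_cell \<sigma>"]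
    by (simp add: flag_coord_affine_ext[OF \<sigma> \<open>k \<le> n\<close>])
  then have "measure lborel Delta * (measure lborel (flag_cell \<sigma>) / real (Suc n))
      = measure lborel Delta * (LINT p|lborel. indicator (flag_cell \<sigma>) p * flag_coord \<sigma> k p)"
    by (simp only: integral_coord[OF \<open>k \<le> n\<close>] times_divide_eq_left times_divide_eq_right)
  then show ?thesis using V by (metis less_irrefl mult_left_cancel)
qed

text \<open>Permuting the vertices by \<open>\<sigma>\<close> preserves the simplex, hence volume,
  and pulls the cell of \<open>\<sigma>\<close> back to the cell of \<open>id\<close>.\<close>

lemma measure_flag_cell_eq:
  assumes \<sigma>: "\<sigma> permutes {..n}"
  shows "measure lborel (flag_cell \<sigma>) = measure lborel (flag_cell id)"
proof -
  note [measurable] = sets_flag_cell[OF \<sigma>] sets_flag_cell[OF permutes_id]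
  have surj: "surj (affine_ext (x \<circ> \<sigma>))"
    by (rule surj_affine_ext[where m = "\<lambda>k. l (\<sigma> k)"]) (rule coord_affine_ext_permute[OF \<sigma>])
  have "affine_ext (x \<circ> \<sigma>) -` Delta = Delta"
    by (auto simp: affine_ext_permute_mem_Delta[OF \<sigma>])
  moreover have "indicator (flag_cell \<sigma>) (affine_ext (x \<circ> \<sigma>) p) = (indicator (flag_cell id) p :: real)" for p
    by (simp add: indicator_def flag_cell_def flag_coord_affine_ext_permute[OF \<sigma>])
  ultimately show ?thesis
    using integral_affine_proportional[OF linear_affine_ext surj, of "indicator (flag_cell \<sigma>)" Delta]
      measure_Delta_pos by simp
qed

text \<open>Off the null set where two coordinates agree, exactly one permutation sorts the
  coordinates, so a point of the simplex lies in exactly one cell.\<close>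

lemma indicator_Delta_eq_sum_cells:
  "AE p in lebesgue. indicator Delta p = (\<Sum>\<sigma> | \<sigma> permutes {..n}. indicator (flag_cell \<sigma>) p :: real)"
proof -
  define N where "N = (\<Union>i\<le>n. \<Union>j\<in>{..n} - {i}. {p. l i p = l j p})"
  have "negligible N"
    unfolding N_def by (auto intro!: negligible_Union negligible_coord_eq)
  then have "AE p in lebesgue. p \<notin> N"
    by (intro AE_not_in) (simp add: negligible_iff_null_sets)
  moreover have "indicator Delta p = (\<Sum>\<sigma> | \<sigma> permutes {..n}. indicator (flag_cell \<sigma>) p :: real)"
    if "p \<notin> N" for p
  proof (cases "p \<in> Delta")
    case False
    then show ?thesis by (auto simp: mem_flag_cell_iff intro!: sum.neutral)
  next
    case True
    \<comment> \<open>The sign is flipped because sorting is increasing while cells require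
      decreasing coordinates.\<close>
    have inj: "inj_on (\<lambda>i. - l i p) {..n}"
      using that by (fastforce simp: N_def inj_on_def)
    obtain \<sigma> where \<sigma>: "\<sigma> permutes {..n}" "\<And>i. i < n \<Longrightarrow> - l (\<sigma> i) p \<le> - l (\<sigma> (Suc i)) p"
      using exists_sorting_permutation[of n "\<lambda>i. - l i p"] by blast
    have "p \<in> flag_cell \<tau> \<longleftrightarrow> \<tau> = \<sigma>" if \<tau>: "\<tau> permutes {..n}" for \<tau>
    proof
      assume "p \<in> flag_cell \<tau>"
      then have "- l (\<tau> i) p \<le> - l (\<tau> (Suc i)) p" if "i < n" for i
        using mem_flag_cell_iff[OF \<tau>] that by simp
      then show "\<tau> = \<sigma>" using sorting_permutation_unique[OF inj \<tau> _ \<sigma>] by blast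
    next
      assume "\<tau> = \<sigma>"
      then show "p \<in> flag_cell \<tau>" using mem_flag_cell_iff[OF \<tau>] \<sigma>(2) True by simp
    qed
    then have "(\<Sum>\<tau> | \<tau> permutes {..n}. indicator (flag_cell \<tau>) p :: real)
        = (\<Sum>\<tau> | \<tau> permutes {..n}. if \<tau> = \<sigma> then 1 else 0)"
      by (intro sum.cong) (auto simp: indicator_def)
    then show ?thesis using True \<sigma> by (simp add: finite_permutations)
  qed
  ultimately show ?thesis by (auto elim: eventually_mono)
qed

text \<open>Integrating the partition gives the volume as a sum over \<open>(n + 1)!\<close> cells
  of equal volume.\<close>

lemma measure_flag_cell:
  assumes "\<sigma> permutes {..n}"
  shows "measure lborel (flag_cell \<sigma>) = measure lebesgue Delta / fact (Suc n)"
proof -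
  have lm: "flag_cell \<tau> \<in> lmeasurable" if "\<tau> permutes {..n}" for \<tau>
    by (rule lmeasurable_compact[OF compact_flag_cell[OF that]])
  have "measure lebesgue Delta = (LINT p|lebesgue. indicator Delta p)" by simp
  also have "\<dots> = (LINT p|lebesgue. (\<Sum>\<tau> | \<tau> permutes {..n}. indicator (flag_cell \<tau>) p))"
    by (rule integral_cong_AE)
       (use indicator_Delta_eq_sum_cells lm lmeasurable_compact[OF compact_Delta]
         in \<open>auto intro!: borel_measurable_sum borel_measurable_indicator\<close>)
  also have "\<dots> = (\<Sum>\<tau> | \<tau> permutes {..n}. measure lebesgue (flag_cell \<tau>))"
    using lm by (subst Bochner_Integration.integral_sum) (auto intro!: lmeasurable_iff_integrable[THEN iffD1])
  also have "\<dots> = (\<Sum>\<tau> | \<tau> permutes {..n}. measure lborel (flag_cell \<sigma>))"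
  proof (intro sum.cong refl)
    fix \<tau> assume "\<tau> \<in> {\<tau>. \<tau> permutes {..n}}"
    then have \<tau>: "\<tau> permutes {..n}" by simp
    show "measure lebesgue (flag_cell \<tau>) = measure lborel (flag_cell \<sigma>)"
      using measure_flag_cell_eq[OF \<tau>] measure_flag_cell_eq[OF assms] sets_flag_cell[OF \<tau>]
      by (simp add: measure_completion)
  qed
  also have "\<dots> = fact (Suc n) * measure lborel (flag_cell \<sigma>)"
  proof -
    have "card {\<tau>. \<tau> permutes {..n}} = fact (Suc n)" by (rule card_permutations) simp_all
    then show ?thesis by (simp del: fact_Suc)
  qed
  finally show ?thesis by (simp del: fact_Suc)
qed

section \<open>The inequality over flags, then over faces\<close>

lemma flag_barycenter_mem_Delta:
  assumes "\<sigma> permutes {..n}" "k \<le> n" shows "flag_barycenter \<sigma> k \<in> Delta"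
proof -
  have "\<sigma> ` {..k} \<subseteq> {..n}"
    using permutes_image[OF assms(1)] assms(2) by (metis atMost_subset_iff image_mono)
  then show ?thesis by (simp add: flag_barycenter_def Delta_def coord_barycenter)
qed

lemma convex_le_on_flag_cell:
  assumes f: "convex_on Delta f" and \<sigma>: "\<sigma> permutes {..n}" and p: "p \<in> flag_cell \<sigma>"
  shows "f p \<le> (\<Sum>k\<le>n. flag_coord \<sigma> k p * f (flag_barycenter \<sigma> k))"
proof -
  have "surj (affine_ext (flag_barycenter \<sigma>))"
    by (rule surj_affine_ext[where m = "flag_coord \<sigma>"]) (rule flag_coord_affine_ext[OF \<sigma>])
  \<comment> \<open>The preimage \<open>y\<close> exhibits \<open>p\<close> as a combination of flag
    barycenters whose weights are the cell coordinates of \<open>p\<close>; Jensen's inequality then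
    applies.\<close>
  then obtain y where y: "p = affine_ext (flag_barycenter \<sigma>) y" by (metis surjD)
  then have coord: "flag_coord \<sigma> k p = l k y" if "k \<le> n" for k
    using flag_coord_affine_ext[OF \<sigma> that] by simp
  have "f (\<Sum>k\<le>n. l k y *\<^sub>R flag_barycenter \<sigma> k) \<le> (\<Sum>k\<le>n. l k y * f (flag_barycenter \<sigma> k))"
    by (rule convex_on_sum[OF _ _ f])
      (use p coord in \<open>auto simp: sum_coord flag_cell_def flag_barycenter_mem_Delta[OF \<sigma>]\<close>)
  then show ?thesis by (simp add: coord y[unfolded affine_ext_def, symmetric])
qed

lemma integral_convex_le_flags:
  assumes f: "convex_on Delta f" and "0 < n"
  shows "(LINT p:Delta|lebesgue. f p) \<le> measure lebesgue Delta / (real (Suc n) * fact (Suc n)) *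
    (\<Sum>\<sigma> | \<sigma> permutes {..n}. \<Sum>k\<le>n. f (flag_barycenter \<sigma> k))"
proof -
  define P where "P = {\<sigma>. \<sigma> permutes {..n}}"
  \<comment> \<open>The term of the affine interpolation at barycenter \<open>k\<close>, cut off
    outside the cell of \<open>\<sigma>\<close>.\<close>
  define g where "g = (\<lambda>\<sigma> k (p::'a). f (flag_barycenter \<sigma> k) * (indicator (flag_cell \<sigma>) p * flag_coord \<sigma> k p))"
  have cells: "\<sigma> \<in> P \<Longrightarrow> flag_cell \<sigma> \<in> sets borel" for \<sigma> by (simp add: P_def sets_flag_cell)
  have int: "integrable lborel (g \<sigma> k)" if "\<sigma> \<in> P" for \<sigma> k
    unfolding g_def
    using borel_integrable_compact[OF compact_flag_cell continuous_flag_coord, of \<sigma> \<sigma> k] that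
    by (auto simp: P_def)
  then have int': "integrable lborel (\<lambda>p. \<Sum>\<sigma>\<in>P. \<Sum>k\<le>n. g \<sigma> k p)" by auto
  then have meas: "(\<lambda>p. \<Sum>\<sigma>\<in>P. \<Sum>k\<le>n. g \<sigma> k p) \<in> borel_measurable lborel" by auto
  have "(LINT p:Delta|lebesgue. f p) \<le> (LINT p|lebesgue. (\<Sum>\<sigma>\<in>P. \<Sum>k\<le>n. g \<sigma> k p))"
    unfolding set_lebesgue_integral_def
  proof (rule integral_mono_AE)
    show "integrable lebesgue (\<lambda>p. indicator Delta p *\<^sub>R f p)"
      using integrable_convex[OF assms] by (simp add: set_integrable_def)
    show "integrable lebesgue (\<lambda>p. \<Sum>\<sigma>\<in>P. \<Sum>k\<le>n. g \<sigma> k p)"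
      using int' meas by (simp only: integrable_completion)
    \<comment> \<open>This bound holds at every point; the exceptional null set enters only when the
      sum of indicators is replaced by that of \<open>Delta\<close>.\<close>
    have "(\<Sum>\<sigma>\<in>P. indicator (flag_cell \<sigma>) p) * f p \<le> (\<Sum>\<sigma>\<in>P. \<Sum>k\<le>n. g \<sigma> k p)" for p
      unfolding sum_distrib_right
    proof (rule sum_mono)
      fix \<sigma> assume "\<sigma> \<in> P"
      then show "indicator (flag_cell \<sigma>) p * f p \<le> (\<Sum>k\<le>n. g \<sigma> k p)"
        using convex_le_on_flag_cell[OF f, of \<sigma> p]
        by (auto simp: P_def g_def indicator_def mult.commute)
    qed
    then show "AE p in lebesgue. indicator Delta p *\<^sub>R f p \<le> (\<Sum>\<sigma>\<in>P. \<Sum>k\<le>n. g \<sigma> k p)"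
      using indicator_Delta_eq_sum_cells by (auto simp: P_def elim!: eventually_mono)
  qed
  \<comment> \<open>The interpolants are Borel measurable, so the integral passes to
    \<open>lborel\<close>, where the cell coordinates were integrated.\<close>
  also have "\<dots> = (LINT p|lborel. (\<Sum>\<sigma>\<in>P. \<Sum>k\<le>n. g \<sigma> k p))"
    by (rule integral_completion[OF meas])
  also have "\<dots> = (\<Sum>\<sigma>\<in>P. \<Sum>k\<le>n. (LINT p|lborel. g \<sigma> k p))"
    by (simp add: int Bochner_Integration.integral_sum Bochner_Integration.integrable_sum)
  also have "\<dots> = (\<Sum>\<sigma>\<in>P. \<Sum>k\<le>n. f (flag_barycenter \<sigma> k) *
      (measure lebesgue Delta / fact (Suc n) / real (Suc n)))"
    by (intro sum.cong refl)
      (simp add: g_def P_def integral_flag_coord measure_flag_cell del: fact_Suc of_nat_Suc)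
  finally show ?thesis
    by (simp add: P_def sum_distrib_left sum_divide_distrib mult.commute del: fact_Suc of_nat_Suc)
qed

lemma Avg_convex_le:
  assumes f: "convex_on Delta f" and "0 < n"
  shows "Avg f Delta \<le> (1 / real (n + 1)) *
       (\<Sum>k = 1..n + 1. (1 / real ((n + 1) choose k)) *
          (\<Sum>K | K \<subseteq> {..n} \<and> card K = k. f (barycenter x K)))"
proof -
  define S where "S = (\<lambda>k. \<Sum>K | K \<subseteq> {..n} \<and> card K = k. f (barycenter x K))"
  have "(\<Sum>\<sigma> | \<sigma> permutes {..n}. \<Sum>k\<le>n. f (flag_barycenter \<sigma> k))
      = (\<Sum>k\<le>n. \<Sum>\<sigma> | \<sigma> permutes {..n}. f (barycenter x (\<sigma> ` {..k})))"
    unfolding flag_barycenter_def by (rule sum.swap)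
  \<comment> \<open>For fixed \<open>k\<close> the image of \<open>{..k}\<close> runs equally often
    over all faces with \<open>Suc k\<close> vertices. The factor \<open>fact (Suc n)\<close> later
    cancels against the volume of a cell.\<close>
  also have "\<dots> = (\<Sum>k\<le>n. fact (Suc n) / real (Suc n choose Suc k) * S (Suc k))"
    unfolding S_def
    by (intro sum.cong refl, subst sum_permutations_image) (auto simp del: fact_Suc binomial_Suc_Suc)
  also have "\<dots> = fact (Suc n) * (\<Sum>k\<le>n. 1 / real (Suc n choose Suc k) * S (Suc k))"
    by (simp add: sum_distrib_left del: fact_Suc binomial_Suc_Suc)
  also have "(\<Sum>k\<le>n. 1 / real (Suc n choose Suc k) * S (Suc k))
      = (\<Sum>k = 1..n + 1. 1 / real ((n + 1) choose k) * S k)"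
    using sum.shift_bounds_cl_Suc_ivl[of "\<lambda>k. 1 / real (Suc n choose k) * S k" 0 n]
    by (simp add: atLeast0AtMost del: binomial_Suc_Suc)
  finally have flags: "(\<Sum>\<sigma> | \<sigma> permutes {..n}. \<Sum>k\<le>n. f (flag_barycenter \<sigma> k))
      = fact (Suc n) * (\<Sum>k = 1..n + 1. 1 / real ((n + 1) choose k) * S k)" .
  have "(LINT p:Delta|lebesgue. f p)
      \<le> 1 / real (n + 1) * (\<Sum>k = 1..n + 1. 1 / real ((n + 1) choose k) * S k) * measure lebesgue Delta"
    using integral_convex_le_flags[OF assms] unfolding flags
    by (simp add: mult.commute del: fact_Suc of_nat_Suc sum.cl_ivl_Suc binomial_Suc_Suc)
  then show ?thesis
    using measure_Delta_pos unfolding Avg_def S_def by (simp add: pos_divide_le_eq)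
qed

end

section \<open>Existence of barycentric coordinates and conclusion\<close>

text \<open>Affinely independent points, one more than the dimension, have the whole space as affine
  hull, which gives coefficients; independence makes them unique.\<close>

lemma exists_barycentric_coordinates:
  fixes x :: "nat \<Rightarrow> 'a::euclidean_space"
  assumes dim: "n = DIM('a)" and inj: "inj_on x {..n}" and indep: "\<not> affine_dependent (x ` {..n})"
  shows "\<exists>l. barycentric_coordinates x n l"
proof -
  have "affine hull (x ` {..n}) = UNIV"
    using indep by (rule affine_independent_span_eq) (use card_image[OF inj] dim in simp)
  then have "\<exists>u. sum u (x ` {..n}) = 1 \<and> (\<Sum>v\<in>x ` {..n}. u v *\<^sub>R v) = p" for p
    unfolding affine_hull_finite[OF finite_imageI[OF finite_atMost]] by blast
  then have "\<exists>u. (\<Sum>i\<le>n. u (x i)) = 1 \<and> (\<Sum>i\<le>n. u (x i) *\<^sub>R x i) = p" for p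
    by (simp add: sum.reindex[OF inj])
  then obtain u where u: "\<And>p. (\<Sum>i\<le>n. u p (x i)) = 1" "\<And>p. (\<Sum>i\<le>n. u p (x i) *\<^sub>R x i) = p"
    by metis
  define l where "l = (\<lambda>i p. if i \<le> n then u p (x i) else 0)"
  have unique: "v i = w i"
    if eq: "(\<Sum>i\<le>n. v i) = (1::real)" "(\<Sum>i\<le>n. w i) = 1"
      "(\<Sum>i\<le>n. v i *\<^sub>R x i) = (\<Sum>i\<le>n. w i *\<^sub>R x i)" and "i \<le> n" for v w i
  proof (rule ccontr)
    assume ne: "v i \<noteq> w i"
    \<comment> \<open>The difference of two coefficient families, moved from indices to points,
      would be an affine dependence.\<close>
    define U where "U = (\<lambda>q. (v - w) (the_inv_into {..n} x q))"
    have U: "U (x j) = v j - w j" if "j \<le> n" for j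
      using that by (simp add: U_def the_inv_into_f_f[OF inj])
    have "sum U (x ` {..n}) = 0" "(\<Sum>q\<in>x ` {..n}. U q *\<^sub>R q) = 0" "U (x i) \<noteq> 0"
      using eq ne \<open>i \<le> n\<close>
      by (simp_all add: sum.reindex[OF inj] U scaleR_diff_left sum_subtractf)
    then have "affine_dependent (x ` {..n})"
      using \<open>i \<le> n\<close> by (subst affine_dependent_explicit_finite) auto
    with indep show False ..
  qed
  have "barycentric_coordinates x n l"
  proof
    show sum: "(\<Sum>i\<le>n. l i p) = 1" and rep: "(\<Sum>i\<le>n. l i p *\<^sub>R x i) = p" for p
      using u[of p] by (simp_all add: l_def)
    show "l i (\<Sum>j\<le>n. v j *\<^sub>R x j) = v i" if "(\<Sum>i\<le>n. v i) = 1" "i \<le> n" for v i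
      using unique[OF sum that(1) rep that(2)] .
  qed (simp add: l_def)
  then show ?thesis by blast
qed

theorem theorem9:
  fixes x :: "nat \<Rightarrow> real ^ 'n"
    and f :: "real ^ 'n \<Rightarrow> real"
    and n :: nat
  assumes n_def: "n = CARD('n)"
    and inj: "inj_on x {0..n}"
    and indep: "\<not> affine_dependent (x ` {0..n})"
    and conv: "convex_on (convex hull (x ` {0..n})) f"
  shows "Avg f (convex hull (x ` {0..n}))
    \<le> (1 / real (n + 1)) *
       (\<Sum>k = 1..n + 1. (1 / real ((n + 1) choose k)) *
          (\<Sum>K\<in>{K. K \<subseteq> {0..n} \<and> card K = k}. f (barycenter x K)))"
proof -
  obtain l where "barycentric_coordinates x n l"
    using exists_barycentric_coordinates[of n x] assms by (auto simp: atLeast0AtMost)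
  then interpret barycentric_coordinates x n l .
  have "0 < n" by (simp add: n_def)
  then show ?thesis
    using Avg_convex_le[of f] conv by (simp only: atLeast0AtMost convex_hull_vertices)
qed

end
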